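(* For every $n\ge 1$, $\lambda\in\mathbb{R}_+$, $c\in\mathbb{R}$ such that $\psi^{(a)}$ has no points of increase in the interval $(c,c+1)$, and $a>0$, let $\mathfrak{d}_n$ and $\mathfrak{d}_n^\dagger$ be the difference operators $$\mathfrak{d}_{n}=\Xi_{2}(x;n)\,\mathrm{I}-\Delta,\qquad \mathfrak{d}_{n}^{\dagger}=\Theta_{1}(x;n)\,\mathrm{I}+\Delta,$$ where $\mathrm{I}$ is the identity operator and $\Delta$ is the forward difference operator. Then $\mathfrak{d}_n$ and $\mathfrak{d}_n^\dagger$ are respectively lowering and raising difference operators associated to the Sobolev-type Charlier polynomials, satisfying $$\mathfrak{d}_{n}[Q_{n}^{\lambda}(x)]=\Xi_{1}(x;n)\,Q_{n-1}^{\lambda}(x),\qquad \mathfrak{d}_{n}^{\dagger}[Q_{n-1}^{\lambda}(x)]=\Theta_{2}(x;n)\,Q_{n}^{\lambda}(x),$$ with $\Xi_k,\Theta_k$ ($k=1,2$) as given in the context. These four coefficients can be given only in terms of the functions $A_1$, $B_1$ and the parameters $a,\lambda,c,n$, through the formulas in the context.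
   Context: Let $a>0$ and let $\psi^{(a)}$ be the Poisson distribution, the discrete measure with mass $e^{-a}a^{x}/x!$ at $x=0,1,2,\ldots$. "No points of increase in $(c,c+1)$" means that $(c,c+1)$ contains no nonnegative integer. $\Delta f(x)=f(x+1)-f(x)$. $\{C_n^{(a)}\}_{n\ge0}$ are the monic Charlier polynomials, orthogonal with respect to $\langle p,q\rangle=\int_0^\infty pq\,d\psi^{(a)}$; $C_{-1}^{(a)}=0$, $C_0^{(a)}=1$, $C_{n+1}^{(a)}(x)=(x-n-a)C_n^{(a)}(x)-na\,C_{n-1}^{(a)}(x)$, $\|C_n^{(a)}\|^2=n!a^n$. $\{Q_n^\lambda\}_{n\ge0}$ is the sequence of monic polynomials ($\deg Q_n^\lambda=n$) orthogonal with respect to $\langle p,q\rangle_\lambda=\int_0^\infty pq\,d\psi^{(a)}+\lambda\,\Delta p(c)\,\Delta q(c)$. Put $$A_{1}(x;n)=1-\lambda \frac{\Delta Q_{n}^{\lambda }(c)}{\|C_{n-1}^{(a)}\|^{2}}\,\frac{C_{n-1}^{(a)}(c)+(x-c)\Delta C_{n-1}^{(a)}(c)}{(x-c)(x-c-1)},\qquad B_{1}(x;n)=\lambda \frac{\Delta Q_{n}^{\lambda }(c)}{\|C_{n-1}^{(a)}\|^{2}}\,\frac{C_{n}^{(a)}(c)+(x-c)\Delta C_{n}^{(a)}(c)}{(x-c)(x-c-1)},$$ $$C_1(x;n)=A_1(x+1;n)-A_1(x;n)-\tfrac1a B_1(x+1;n),$$ $$D_1(x;n)=nA_1(x+1;n)-B_1(x;n)+\tfrac{x-n+1}{a}B_1(x+1;n),$$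 $$A_2(x;n)=\frac{-B_1(x;n-1)}{a(n-1)},\qquad B_2(x;n)=A_1(x;n-1)+\frac{x-n-a+1}{a(n-1)}B_1(x;n-1),$$ $$C_2(x;n)=\frac{aB_1(x;n-1)-a(n-1)A_1(x+1;n-1)-(x-n+2)B_1(x+1;n-1)}{a^2(n-1)},$$ $$D_2(x;n)=\frac{a(n-1)(1-n+x)A_1(x+1;n-1)+a(-1+a+n-x)B_1(x;n-1)}{a^2(n-1)}-A_1(x;n-1)+\frac{[(n-x-2)(n-x-1)-a(1+x)]B_1(x+1;n-1)}{a^2(n-1)},$$ $$\Lambda(x;n)=A_1(x;n)B_2(x;n)-B_1(x;n)A_2(x;n),$$ and for $k=1,2$ $$\Xi_k(x;n)=\frac{C_1(x;n)B_k(x;n)-A_k(x;n)D_1(x;n)}{\Lambda(x;n)},\qquad \Theta_k(x;n)=\frac{C_2(x;n)B_k(x;n)-A_k(x;n)D_2(x;n)}{\Lambda(x;n)}.$$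
   Formalization: At n=1 the formulas for A_2, B_2, C_2, D_2 divide by n-1=0; there A_1(x;0)=1, B_1(x;0)=0, B_1(x;0)/(n-1) is read as 0 and the factor n-1 of the A_1 terms is cancelled. The identities hold for x outside {c-1,c,c+1} with Lambda(x;n) nonzero. *)

theory Defs
  imports "HOL-Probability.Probability" "HOL-Computational_Algebra.Polynomial"
begin

definition fwd_diff :: "(real \<Rightarrow> real) \<Rightarrow> real \<Rightarrow> real" where
  "fwd_diff f x = f (x + 1) - f x"

definition charlier_measure :: "real \<Rightarrow> real pmf" where
  "charlier_measure a = map_pmf real (poisson_pmf a)"

definition charlier_inner :: "real \<Rightarrow> real poly \<Rightarrow> real poly \<Rightarrow> real" where
  "charlier_inner a p q = measure_pmf.expectation (charlier_measure a) (\<lambda>x. poly p x * poly q x)"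

definition sobolev_inner :: "real \<Rightarrow> real \<Rightarrow> real \<Rightarrow> real poly \<Rightarrow> real poly \<Rightarrow> real" where
  "sobolev_inner a lam c p q =
     charlier_inner a p q + lam * fwd_diff (poly p) c * fwd_diff (poly q) c"

text \<open>The points of increase of the Poisson distribution are the nonnegative integers.\<close>

definition no_increase_points :: "real \<Rightarrow> bool" where
  "no_increase_points c \<longleftrightarrow> (\<forall>k::nat. real k \<notin> {c<..<c + 1})"

definition monic_orthogonal_seq :: "(real poly \<Rightarrow> real poly \<Rightarrow> real) \<Rightarrow> (nat \<Rightarrow> real poly) \<Rightarrow> bool" where
  "monic_orthogonal_seq ip P \<longleftrightarrow>
     (\<forall>n. degree (P n) = n \<and> lead_coeff (P n) = 1) \<and>
     (\<forall>m n. m \<noteq> n \<longrightarrow> ip (P m) (P n) = 0)"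

text \<open>The monic Charlier polynomials. The second clause is the three-term recurrence for
  index \<open>0\<close>, where the term with \<open>C\<^sub>-\<^sub>1 = 0\<close> drops out.\<close>

fun charlier :: "real \<Rightarrow> nat \<Rightarrow> real poly" where
  "charlier a 0 = 1"
| "charlier a (Suc 0) = [:- a, 1:]"
| "charlier a (Suc (Suc n)) =
     [:- real (Suc n) - a, 1:] * charlier a (Suc n) - smult (real (Suc n) * a) (charlier a n)"

definition charlier_norm2 :: "real \<Rightarrow> nat \<Rightarrow> real" where
  "charlier_norm2 a n = charlier_inner a (charlier a n) (charlier a n)"

text \<open>In the next two definitions the truncated index \<open>n - 1\<close> for \<open>n = 0\<close> is harmless: the factor
  \<open>fwd_diff (poly (Q 0)) c\<close> vanishes, so that \<open>A\<^sub>1(x;0) = 1\<close> and \<open>B\<^sub>1(x;0) = 0\<close>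
  (see \<open>coef_A1_0\<close> and \<open>coef_B1_0\<close>).\<close>

definition coef_A1 :: "real \<Rightarrow> real \<Rightarrow> real \<Rightarrow> (nat \<Rightarrow> real poly) \<Rightarrow> nat \<Rightarrow> real \<Rightarrow> real" where
  "coef_A1 a lam c Q n x =
     1 - lam * (fwd_diff (poly (Q n)) c / charlier_norm2 a (n - 1)) *
       ((poly (charlier a (n - 1)) c + (x - c) * fwd_diff (poly (charlier a (n - 1))) c) /
        ((x - c) * (x - c - 1)))"

definition coef_B1 :: "real \<Rightarrow> real \<Rightarrow> real \<Rightarrow> (nat \<Rightarrow> real poly) \<Rightarrow> nat \<Rightarrow> real \<Rightarrow> real" where
  "coef_B1 a lam c Q n x =
     lam * (fwd_diff (poly (Q n)) c / charlier_norm2 a (n - 1)) *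
       ((poly (charlier a n) c + (x - c) * fwd_diff (poly (charlier a n)) c) /
        ((x - c) * (x - c - 1)))"

lemma coef_A1_0: "degree (Q 0) = 0 \<Longrightarrow> coef_A1 a lam c Q 0 x = 1"
  by (auto simp: coef_A1_def fwd_diff_def elim!: degree_eq_zeroE)

lemma coef_B1_0: "degree (Q 0) = 0 \<Longrightarrow> coef_B1 a lam c Q 0 x = 0"
  by (auto simp: coef_B1_def fwd_diff_def elim!: degree_eq_zeroE)

text \<open>The remaining coefficients are functionals of two arbitrary families \<open>A\<close> and \<open>B\<close>, to be
  instantiated with \<open>A\<^sub>1\<close> and \<open>B\<^sub>1\<close>; this expresses that they depend on nothing but \<open>A\<^sub>1\<close>, \<open>B\<^sub>1\<close>
  and the parameters.\<close>

type_synonym coef = "nat \<Rightarrow> real \<Rightarrow> real"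

definition coef_C1 :: "real \<Rightarrow> coef \<Rightarrow> coef \<Rightarrow> coef" where
  "coef_C1 a A B n x = A n (x + 1) - A n x - 1 / a * B n (x + 1)"

definition coef_D1 :: "real \<Rightarrow> coef \<Rightarrow> coef \<Rightarrow> coef" where
  "coef_D1 a A B n x = real n * A n (x + 1) - B n x + (x - real n + 1) / a * B n (x + 1)"

text \<open>For \<open>n = 1\<close> the coefficients with index 2 have denominators \<open>n - 1 = 0\<close>. There
  \<open>B\<^sub>1(x;0) = 0\<close>, and the terms \<open>B\<^sub>1(x;n-1)/(n-1)\<close> are read as \<open>0\<close>, which is
  also the value of \<open>0 / 0\<close> in HOL. The terms with \<open>A\<^sub>1\<close> over \<open>n - 1\<close> have the
  numerator factor \<open>n - 1\<close>, which is cancelled in \<open>coef_C2\<close> and \<open>coef_D2\<close>. For \<open>n \<ge> 2\<close> the lemmas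
  \<open>coef_C2_eq\<close> and \<open>coef_D2_eq\<close> give the uncancelled fractions.\<close>

definition coef_A2 :: "real \<Rightarrow> coef \<Rightarrow> coef \<Rightarrow> coef" where
  "coef_A2 a A B n x = - B (n - 1) x / (a * (real n - 1))"

definition coef_B2 :: "real \<Rightarrow> coef \<Rightarrow> coef \<Rightarrow> coef" where
  "coef_B2 a A B n x = A (n - 1) x + (x - real n - a + 1) / (a * (real n - 1)) * B (n - 1) x"

definition coef_C2 :: "real \<Rightarrow> coef \<Rightarrow> coef \<Rightarrow> coef" where
  "coef_C2 a A B n x =
     (a * B (n - 1) x - (x - real n + 2) * B (n - 1) (x + 1)) / (a\<^sup>2 * (real n - 1))
     - A (n - 1) (x + 1) / a"

definition coef_D2 :: "real \<Rightarrow> coef \<Rightarrow> coef \<Rightarrow> coef" where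
  "coef_D2 a A B n x =
     (1 - real n + x) * A (n - 1) (x + 1) / a
     + a * (- 1 + a + real n - x) * B (n - 1) x / (a\<^sup>2 * (real n - 1))
     - A (n - 1) x
     + ((real n - x - 2) * (real n - x - 1) - a * (1 + x)) * B (n - 1) (x + 1)
         / (a\<^sup>2 * (real n - 1))"

lemma coef_C2_eq:
  assumes "n \<ge> 2" "a \<noteq> 0"
  shows "coef_C2 a A B n x =
     (a * B (n - 1) x - a * (real n - 1) * A (n - 1) (x + 1)
       - (x - real n + 2) * B (n - 1) (x + 1)) / (a\<^sup>2 * (real n - 1))"
proof -
  have "A (n - 1) (x + 1) / a = a * (real n - 1) * A (n - 1) (x + 1) / (a\<^sup>2 * (real n - 1))"
    using assms by (simp add: power2_eq_square)
  then show ?thesis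
    by (simp add: coef_C2_def diff_divide_distrib)
qed

lemma coef_D2_eq:
  assumes "n \<ge> 2" "a \<noteq> 0"
  shows "coef_D2 a A B n x =
     (a * (real n - 1) * (1 - real n + x) * A (n - 1) (x + 1)
       + a * (- 1 + a + real n - x) * B (n - 1) x) / (a\<^sup>2 * (real n - 1))
     - A (n - 1) x
     + ((real n - x - 2) * (real n - x - 1) - a * (1 + x)) * B (n - 1) (x + 1)
         / (a\<^sup>2 * (real n - 1))"
proof -
  have "(1 - real n + x) * A (n - 1) (x + 1) / a =
      a * (real n - 1) * (1 - real n + x) * A (n - 1) (x + 1) / (a\<^sup>2 * (real n - 1))"
    using assms by (simp add: power2_eq_square)
  then show ?thesis
    by (simp add: coef_D2_def add_divide_distrib)
qed

definition coef_A :: "nat \<Rightarrow> real \<Rightarrow> coef \<Rightarrow> coef \<Rightarrow> coef" where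
  "coef_A k a A B = (if k = 1 then A else coef_A2 a A B)"

definition coef_B :: "nat \<Rightarrow> real \<Rightarrow> coef \<Rightarrow> coef \<Rightarrow> coef" where
  "coef_B k a A B = (if k = 1 then B else coef_B2 a A B)"

definition Lambda :: "real \<Rightarrow> coef \<Rightarrow> coef \<Rightarrow> coef" where
  "Lambda a A B n x = A n x * coef_B2 a A B n x - B n x * coef_A2 a A B n x"

definition Xi :: "nat \<Rightarrow> real \<Rightarrow> coef \<Rightarrow> coef \<Rightarrow> coef" where
  "Xi k a A B n x =
     (coef_C1 a A B n x * coef_B k a A B n x - coef_A k a A B n x * coef_D1 a A B n x)
       / Lambda a A B n x"

definition Theta :: "nat \<Rightarrow> real \<Rightarrow> coef \<Rightarrow> coef \<Rightarrow> coef" where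
  "Theta k a A B n x =
     (coef_C2 a A B n x * coef_B k a A B n x - coef_A k a A B n x * coef_D2 a A B n x)
       / Lambda a A B n x"

definition lowering_op :: "real \<Rightarrow> coef \<Rightarrow> coef \<Rightarrow> nat \<Rightarrow> (real \<Rightarrow> real) \<Rightarrow> real \<Rightarrow> real" where
  "lowering_op a A B n f x = Xi 2 a A B n x * f x - fwd_diff f x"

definition raising_op :: "real \<Rightarrow> coef \<Rightarrow> coef \<Rightarrow> nat \<Rightarrow> (real \<Rightarrow> real) \<Rightarrow> real \<Rightarrow> real" where
  "raising_op a A B n f x = Theta 1 a A B n x * f x + fwd_diff f x"

end

theory Submission
  imports Defs
begin

text \<open>Orthogonality turns \<open>Q\<^sub>n\<close> into \<open>C\<^sub>n\<close> minus a multiple of the difference of the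
  Christoffel--Darboux kernel at \<open>c\<close>, so that \<open>Q\<^sub>n = A\<^sub>1 C\<^sub>n + B\<^sub>1 C\<^sub>n\<^sub>-\<^sub>1\<close>. By the recurrence and
  \<open>\<Delta> C\<^sub>n = n C\<^sub>n\<^sub>-\<^sub>1\<close>, also \<open>Q\<^sub>n\<^sub>-\<^sub>1\<close>, \<open>\<Delta> Q\<^sub>n\<close> and \<open>\<Delta> Q\<^sub>n\<^sub>-\<^sub>1\<close> are combinations of \<open>C\<^sub>n\<close> and
  \<open>C\<^sub>n\<^sub>-\<^sub>1\<close>; solving the \<open>2 \<times> 2\<close> system with determinant \<open>\<Lambda>\<close> gives the ladder relations.
  Up to the factor \<open>(x - c)\<^sup>2 (x - c - 1)\<^sup>2\<close>, \<open>\<Lambda>\<close> is a polynomial of degree 4 with leading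
  coefficient \<open>1 + \<lambda> \<Delta>Q\<^sub>n\<^sub>-\<^sub>1(c) \<Delta>C\<^sub>n\<^sub>-\<^sub>1(c) / \<parallel>C\<^sub>n\<^sub>-\<^sub>1\<parallel>\<^sup>2\<close>, which is positive because \<open>\<Delta>Q\<^sub>n\<^sub>-\<^sub>1(c)\<close> and
  \<open>\<Delta>C\<^sub>n\<^sub>-\<^sub>1(c)\<close> have the same sign.\<close>

section \<open>Charlier polynomials: recurrence, forward and backward shifts, leading term\<close>

text \<open>The factor \<open>real n\<close> kills the last term at \<open>n = 0\<close>, so the
  truncated index \<open>n - 1\<close> is harmless and one identity covers both recursive clauses of
  \<open>charlier\<close>.\<close>

lemma poly_charlier_Suc:
  "poly (charlier a (Suc n)) x =
    (x - real n - a) * poly (charlier a n) x - real n * a * poly (charlier a (n - 1)) x"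
  by (cases n) (simp_all add: algebra_simps)

text \<open>Shifting the recurrence leaves a term of index \<open>n - 1\<close>, which the unshifted
  recurrence for index \<open>Suc n\<close> eliminates.\<close>

lemma poly_charlier_shift:
  "poly (charlier a n) (x + 1) = poly (charlier a n) x + real n * poly (charlier a (n - 1)) x"
proof (induction a n rule: charlier.induct)
  case (3 a n)
  have rec: "poly (charlier a (Suc (Suc n))) y =
      (y - (real n + 1) - a) * poly (charlier a (Suc n)) y - (real n + 1) * a * poly (charlier a n) y" for y
    using poly_charlier_Suc[of a "Suc n" y] by (simp add: add.commute)
  have IH1: "poly (charlier a (Suc n)) (x + 1) =
      poly (charlier a (Suc n)) x + (real n + 1) * poly (charlier a n) x"
    using 3(1) by (simp add: add.commute)
  have "poly (charlier a (Suc (Suc n))) (x + 1) =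
      poly (charlier a (Suc (Suc n))) x + (real n + 2) * poly (charlier a (Suc n)) x"
    using poly_charlier_Suc[of a n x] unfolding rec IH1 3(2) by algebra
  then show ?case
    by (simp add: add.commute del: charlier.simps)
qed auto

text \<open>With respect to the Poisson weight, the operator taking f(x) to x f(x - 1) - a f(x) is
  \<open>a\<close> times the adjoint of \<Delta>. This form of the raising relation lets
  orthogonality follow by summation by parts.\<close>

lemma poly_charlier_backward:
  "poly (charlier a (Suc n)) x = x * poly (charlier a n) (x - 1) - a * poly (charlier a n) x"
proof (induction n)
  case (Suc n)
  have "poly (charlier a (Suc n)) (x - 1) =
      poly (charlier a (Suc n)) x - real (Suc n) * poly (charlier a n) (x - 1)"
    using poly_charlier_shift[of a "Suc n" "x - 1"] by simp
  then have "x * poly (charlier a (Suc n)) (x - 1) =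
      x * poly (charlier a (Suc n)) x - real (Suc n) * (x * poly (charlier a n) (x - 1))"
    by (simp add: right_diff_distrib)
  also have "x * poly (charlier a n) (x - 1) =
      poly (charlier a (Suc n)) x + a * poly (charlier a n) x"
    using Suc by simp
  finally show ?case
    by (simp add: algebra_simps)
qed simp

lemma degree_lead_coeff_charlier:
  "degree (charlier a n) = n \<and> lead_coeff (charlier a n) = 1"
proof (induction a n rule: charlier.induct)
  case (3 a n)
  let ?p = "[:- real (Suc n) - a, 1:] * charlier a (Suc n)"
  let ?q = "smult (real (Suc n) * a) (charlier a n)"
  have nz: "charlier a (Suc n) \<noteq> 0"
    using 3 by auto
  have p: "degree ?p = Suc (Suc n)" "lead_coeff ?p = 1"
    using 3 nz degree_mult_eq[of "[:- real (Suc n) - a, 1:]" "charlier a (Suc n)"]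
      lead_coeff_mult[of "[:- real (Suc n) - a, 1:]" "charlier a (Suc n)"]
    by (auto simp del: mult_pCons_left)
  have "degree ?q \<le> n"
    using 3 by simp
  then have q: "degree ?q < degree ?p"
    using p by linarith
  have "degree (?p - ?q) = degree ?p"
    using degree_add_eq_left[of "- ?q" ?p] q by simp
  moreover have "coeff ?q (Suc (Suc n)) = 0"
    using q p by (intro coeff_eq_0) simp
  ultimately show ?case
    using p by (simp del: mult_pCons_left)
qed auto

section \<open>Integrability and expectations of polynomials under the Poisson distribution\<close>

text \<open>\<open>real n ^ k / fact k\<close> is one term of the exponential series at
  \<open>real n\<close>, so the series is dominated by a multiple of the exponential series at
  \<open>a * exp 1\<close>. Hence all Poisson moments are finite.\<close>

lemma summable_power_mult_exp_series:
  fixes a :: real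
  assumes "a > 0"
  shows "summable (\<lambda>n. real n ^ k * (a ^ n / fact n))"
proof (rule summable_comparison_test')
  show "summable (\<lambda>n. fact k * (inverse (fact n) * (a * exp 1) ^ n))"
    by (intro summable_mult summable_exp)
  fix n :: nat
  have "real n ^ k / fact k \<le> exp (real n)"
    using sum_le_suminf[of "\<lambda>j. inverse (fact j) * real n ^ j" "{k}"] summable_exp[of "real n"]
    by (simp add: exp_def divide_inverse mult.commute)
  then have "real n ^ k \<le> fact k * exp (real n)"
    by (simp add: field_simps)
  then have "real n ^ k * (a ^ n / fact n) \<le> fact k * exp (real n) * (a ^ n / fact n)"
    using assms by (intro mult_right_mono) auto
  also have "exp (real n) = exp 1 ^ n"
    using exp_of_nat_mult[of n "1::real"] by simp
  finally show "norm (real n ^ k * (a ^ n / fact n)) \<le> fact k * (inverse (fact n) * (a * exp 1) ^ n)"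
    using assms by (simp add: field_simps)
qed

lemma integrable_poisson_pmf_iff:
  fixes f :: "nat \<Rightarrow> real"
  assumes "a > 0"
  shows "integrable (poisson_pmf a) f \<longleftrightarrow> summable (\<lambda>n. \<bar>f n\<bar> * (a ^ n / fact n))"
proof -
  have "integrable (poisson_pmf a) f \<longleftrightarrow> summable (\<lambda>n. exp (- a) * (\<bar>f n\<bar> * (a ^ n / fact n)))"
    unfolding measure_pmf_eq_density using assms
    by (subst integrable_density)
       (auto simp: integrable_count_space_nat_iff abs_mult mult_ac)
  then show ?thesis
    by (simp only: summable_cmult_iff exp_not_eq_zero) simp
qed

lemma expectation_poisson_pmf:
  fixes f :: "nat \<Rightarrow> real"
  assumes "a > 0" "integrable (poisson_pmf a) f"
  shows "(\<lambda>n. f n * (a ^ n / fact n) * exp (- a)) sums measure_pmf.expectation (poisson_pmf a) f"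
proof -
  have int: "integrable (count_space UNIV) (\<lambda>n. pmf (poisson_pmf a) n * f n)"
    using assms(2) unfolding measure_pmf_eq_density
    by (subst (asm) integrable_density) auto
  have "measure_pmf.expectation (poisson_pmf a) f =
      (\<integral>n. pmf (poisson_pmf a) n * f n \<partial>count_space UNIV)"
    unfolding measure_pmf_eq_density by (subst integral_density) auto
  then show ?thesis
    using sums_integral_count_space_nat[OF int] assms(1) by (simp add: mult_ac)
qed

lemma integrable_poisson_pmf_poly:
  assumes "a > 0"
  shows "integrable (poisson_pmf a) (\<lambda>n. poly p (real n))"
proof -
  have "integrable (poisson_pmf a) (\<lambda>n. real n ^ k)" for k
    using summable_power_mult_exp_series[OF assms, of k]
    by (simp add: integrable_poisson_pmf_iff[OF assms])
  then show ?thesis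
    unfolding poly_altdef by (intro Bochner_Integration.integrable_sum integrable_mult_right)
qed

text \<open>The Stein-Chen identity: the factor \<open>real n\<close> cancels against the factorial
  in the weight, and reindexing by one releases a factor \<open>a\<close>.\<close>

lemma expectation_poisson_pmf_shift:
  fixes p :: "real poly"
  assumes "a > 0"
  shows "measure_pmf.expectation (poisson_pmf a) (\<lambda>n. real n * poly p (real n)) =
    a * measure_pmf.expectation (poisson_pmf a) (\<lambda>n. poly p (real n + 1))"
proof -
  have "integrable (poisson_pmf a) (\<lambda>n. real n * poly p (real n))"
    using integrable_poisson_pmf_poly[OF assms, of "[:0, 1:] * p"] by simp
  then have "(\<lambda>n. real n * poly p (real n) * (a ^ n / fact n) * exp (- a)) sums
      measure_pmf.expectation (poisson_pmf a) (\<lambda>n. real n * poly p (real n))"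
    by (rule expectation_poisson_pmf[OF assms])
  \<comment> \<open>The term at 0 vanishes, so the series may start at 1 without changing its
    sum.\<close>
  then have 1: "(\<lambda>n. real (Suc n) * poly p (real (Suc n)) * (a ^ Suc n / fact (Suc n)) * exp (- a)) sums
      measure_pmf.expectation (poisson_pmf a) (\<lambda>n. real n * poly p (real n))"
    by (subst sums_Suc_iff) simp
  have "integrable (poisson_pmf a) (\<lambda>n. poly p (real n + 1))"
    using integrable_poisson_pmf_poly[OF assms, of "p \<circ>\<^sub>p [:1, 1:]"]
    by (simp add: poly_pcompose add.commute)
  then have "(\<lambda>n. a * (poly p (real n + 1) * (a ^ n / fact n) * exp (- a))) sums
      (a * measure_pmf.expectation (poisson_pmf a) (\<lambda>n. poly p (real n + 1)))"
    by (intro sums_mult expectation_poisson_pmf[OF assms])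
  also have "(\<lambda>n. a * (poly p (real n + 1) * (a ^ n / fact n) * exp (- a))) =
      (\<lambda>n. real (Suc n) * poly p (real (Suc n)) * (a ^ Suc n / fact (Suc n)) * exp (- a))"
  proof
    fix n
    have "real (Suc n) \<noteq> 0"
      by simp
    then show "a * (poly p (real n + 1) * (a ^ n / fact n) * exp (- a)) =
        real (Suc n) * poly p (real (Suc n)) * (a ^ Suc n / fact (Suc n)) * exp (- a)"
      unfolding fact_Suc by (simp add: field_simps del: of_nat_Suc) (simp add: add.commute)
  qed
  finally show ?thesis
    using 1 by (rule sums_unique2[symmetric])
qed

section \<open>Orthogonality and norms of the Charlier polynomials\<close>

lemma charlier_inner_altdef:
  "charlier_inner a p q =
    measure_pmf.expectation (poisson_pmf a) (\<lambda>n. poly (p * q) (real n))"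
  by (simp add: charlier_inner_def charlier_measure_def)

lemma charlier_inner_commute: "charlier_inner a p q = charlier_inner a q p"
  by (simp add: charlier_inner_def mult.commute)

lemma charlier_inner_add_right:
  assumes "a > 0"
  shows "charlier_inner a p (q + r) = charlier_inner a p q + charlier_inner a p r"
  using Bochner_Integration.integral_add[OF integrable_poisson_pmf_poly[OF assms, of "p * q"]
      integrable_poisson_pmf_poly[OF assms, of "p * r"]]
  by (simp add: charlier_inner_altdef algebra_simps)

lemma charlier_inner_smult_right:
  "charlier_inner a p (smult k q) = k * charlier_inner a p q"
  by (simp add: charlier_inner_altdef mult.left_commute[of _ k])

lemma charlier_inner_sum_right:
  assumes "a > 0" "finite I"
  shows "charlier_inner a p (\<Sum>i\<in>I. smult (k i) (q i)) = (\<Sum>i\<in>I. k i * charlier_inner a p (q i))"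
  using assms(2)
proof (induction rule: finite_induct)
  case empty
  show ?case by (simp add: charlier_inner_def)
next
  case (insert i I)
  then show ?case
    by (simp add: charlier_inner_add_right[OF assms(1)] charlier_inner_smult_right)
qed

text \<open>Summation by parts: the composition is q(x + 1), so the bracket pairs
  \<open>charlier a n\<close> with \<Delta>q. It combines the backward relation with the Stein-Chen
  identity.\<close>

lemma charlier_inner_Suc:
  assumes "a > 0"
  shows "charlier_inner a (charlier a (Suc n)) q =
    a * (charlier_inner a (charlier a n) (q \<circ>\<^sub>p [:1, 1:]) - charlier_inner a (charlier a n) q)"
proof -
  let ?E = "measure_pmf.expectation (poisson_pmf a)"
  \<comment> \<open>This is C(x - 1) q(x), with C the polynomial of index \<open>n\<close>;
    replacing x by x + 1 moves the shift onto \<open>q\<close>.\<close>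
  let ?r = "(charlier a n \<circ>\<^sub>p [:-1, 1:]) * q"
  have "charlier_inner a (charlier a (Suc n)) q =
      ?E (\<lambda>i. real i * poly ?r (real i) - a * poly (charlier a n * q) (real i))"
    unfolding charlier_inner_altdef
    by (simp add: poly_charlier_backward poly_pcompose algebra_simps del: charlier.simps)
  also have "\<dots> = ?E (\<lambda>i. real i * poly ?r (real i)) - a * ?E (\<lambda>i. poly (charlier a n * q) (real i))"
    using integrable_poisson_pmf_poly[OF assms, of "[:0, 1:] * ?r"]
      integrable_poisson_pmf_poly[OF assms, of "charlier a n * q"]
    by (subst Bochner_Integration.integral_diff) (auto simp: mult.assoc)
  also have "?E (\<lambda>i. real i * poly ?r (real i)) = a * ?E (\<lambda>i. poly ?r (real i + 1))"
    by (rule expectation_poisson_pmf_shift[OF assms])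
  also have "(\<lambda>i. poly ?r (real i + 1)) = (\<lambda>i. poly (charlier a n * (q \<circ>\<^sub>p [:1, 1:])) (real i))"
    by (simp add: poly_pcompose add.commute)
  finally show ?thesis
    by (simp add: charlier_inner_altdef algebra_simps)
qed

lemma charlier_pcompose_shift:
  "charlier a n \<circ>\<^sub>p [:1, 1:] = charlier a n + smult (real n) (charlier a (n - 1))"
proof -
  have "poly (charlier a n \<circ>\<^sub>p [:1, 1:]) = poly (charlier a n + smult (real n) (charlier a (n - 1)))"
    using poly_charlier_shift[of a n] by (simp add: poly_pcompose add.commute fun_eq_iff)
  then show ?thesis
    by (simp only: poly_eq_poly_eq_iff)
qed

text \<open>Since \<Delta> maps the polynomial of index \<open>Suc n\<close> to
  \<open>real (Suc n)\<close> times that of index \<open>n\<close>, summation by parts lowers both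
  indices at once.\<close>

lemma charlier_inner_Suc_Suc:
  assumes "a > 0"
  shows "charlier_inner a (charlier a (Suc m)) (charlier a (Suc n)) =
    a * real (Suc n) * charlier_inner a (charlier a m) (charlier a n)"
  by (simp add: charlier_inner_Suc[OF assms] charlier_pcompose_shift charlier_inner_add_right[OF assms]
      charlier_inner_smult_right del: charlier.simps)

lemma charlier_inner_Suc_0:
  assumes "a > 0"
  shows "charlier_inner a (charlier a (Suc m)) (charlier a 0) = 0"
  by (subst charlier_inner_Suc[OF assms]) (simp add: pcompose_1)

text \<open>Lowering both indices together ends when one of them is 0. If the other is positive, the
  product vanishes because \<Delta>1 = 0; otherwise the accumulated factors give the squared
  norm.\<close>

lemma charlier_inner_charlier:
  assumes "a > 0"
  shows "charlier_inner a (charlier a m) (charlier a n) = (if m = n then fact n * a ^ n else 0)"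
proof (induction m arbitrary: n)
  case 0
  show ?case
  proof (cases n)
    case 0
    then show ?thesis by (simp add: charlier_inner_altdef)
  next
    case (Suc k)
    then show ?thesis
      using charlier_inner_Suc_0[OF assms, of k] by (simp only: charlier_inner_commute) simp
  qed
next
  case (Suc m)
  show ?case
  proof (cases n)
    case 0
    then show ?thesis
      using charlier_inner_Suc_0[OF assms, of m] by simp
  next
    case (Suc k)
    then show ?thesis
      using Suc.IH[of k] by (simp add: charlier_inner_Suc_Suc[OF assms] algebra_simps del: charlier.simps)
  qed
qed

lemma charlier_norm2_altdef: "a > 0 \<Longrightarrow> charlier_norm2 a n = fact n * a ^ n"
  by (simp add: charlier_norm2_def charlier_inner_charlier)

lemma charlier_norm2_pos: "a > 0 \<Longrightarrow> charlier_norm2 a n > 0"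
  by (simp add: charlier_norm2_altdef)

section \<open>The Christoffel-Darboux kernel and its difference in one argument\<close>

text \<open>The recurrences at \<open>x\<close> and \<open>y\<close> share their coefficients, so
  the new cross product is \<open>x - y\<close> times the new summand plus the old cross product, up
  to norm factors.\<close>

lemma charlier_christoffel_darboux:
  assumes "a > 0"
  shows "(x - y) * (\<Sum>k\<le>n. poly (charlier a k) x * poly (charlier a k) y / charlier_norm2 a k) =
    (poly (charlier a (Suc n)) x * poly (charlier a n) y -
     poly (charlier a n) x * poly (charlier a (Suc n)) y) / charlier_norm2 a n"
proof (induction n)
  case 0
  show ?case using assms by (simp add: charlier_norm2_altdef)
next
  case (Suc n)
  let ?h = "charlier_norm2 a n" and ?c = "\<lambda>k. poly (charlier a k)"
  have h: "charlier_norm2 a (Suc n) = real (Suc n) * a * ?h"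
    using assms by (simp add: charlier_norm2_altdef)
  have rec: "?c (Suc (Suc n)) z = (z - real (Suc n) - a) * ?c (Suc n) z - real (Suc n) * a * ?c n z" for z
    using poly_charlier_Suc[of a "Suc n" z] by simp
  have pos: "?h \<noteq> 0" "real (Suc n) * a \<noteq> 0"
    using charlier_norm2_pos[OF assms, of n] assms by simp_all
  have "(x - y) * (\<Sum>k\<le>Suc n. ?c k x * ?c k y / charlier_norm2 a k) =
      (?c (Suc n) x * ?c n y - ?c n x * ?c (Suc n) y) / ?h
        + (x - y) * (?c (Suc n) x * ?c (Suc n) y) / (real (Suc n) * a * ?h)"
    unfolding sum.atMost_Suc distrib_left Suc h by simp
  also have "\<dots> = (real (Suc n) * a * (?c (Suc n) x * ?c n y - ?c n x * ?c (Suc n) y)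
        + (x - y) * (?c (Suc n) x * ?c (Suc n) y)) / (real (Suc n) * a * ?h)"
    using pos by (simp add: add_divide_distrib del: of_nat_Suc charlier.simps)
  also have "real (Suc n) * a * (?c (Suc n) x * ?c n y - ?c n x * ?c (Suc n) y)
        + (x - y) * (?c (Suc n) x * ?c (Suc n) y) =
      ?c (Suc (Suc n)) x * ?c (Suc n) y - ?c (Suc n) x * ?c (Suc (Suc n)) y"
    unfolding rec by algebra
  finally show ?case
    unfolding h .
qed

text \<open>The sum is the kernel at \<open>c + 1\<close> minus the kernel at \<open>c\<close>.
  Christoffel-Darboux at these two points produces the poles and the rational factors that occur in
  \<open>coef_A1\<close> and \<open>coef_B1\<close> for index \<open>Suc n\<close>.\<close>

lemma charlier_kernel_fwd_diff:
  fixes n :: nat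
  assumes "a > 0" "x \<noteq> c" "x \<noteq> c + 1"
  defines "C \<equiv> \<lambda>k. poly (charlier a k)"
  shows "(\<Sum>k\<le>n. fwd_diff (C k) c / charlier_norm2 a k * C k x) =
    ((C n c + (x - c) * fwd_diff (C n) c) / ((x - c) * (x - c - 1)) * C (Suc n) x
     - (C (Suc n) c + (x - c) * fwd_diff (C (Suc n)) c) / ((x - c) * (x - c - 1)) * C n x)
      / charlier_norm2 a n"
proof -
  let ?h = "charlier_norm2 a" and ?u = "x - c"
  have nz: "?u \<noteq> 0" "?u - 1 \<noteq> 0" "?h n \<noteq> 0"
    using assms(2,3) charlier_norm2_pos[OF assms(1), of n] by auto
  define K where "K y = (\<Sum>k\<le>n. C k x * C k y / ?h k)" for y
  have K0: "K c = (C (Suc n) x * C n c - C n x * C (Suc n) c) / ?h n / ?u"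
    and K1: "K (c + 1) = (C (Suc n) x * C n (c + 1) - C n x * C (Suc n) (c + 1)) / ?h n / (?u - 1)"
    using charlier_christoffel_darboux[OF assms(1), of x c n]
      charlier_christoffel_darboux[OF assms(1), of x "c + 1" n] nz
    unfolding K_def C_def by (simp_all add: eq_divide_eq mult.commute diff_diff_eq del: charlier.simps)
  have "(\<Sum>k\<le>n. fwd_diff (C k) c / ?h k * C k x) = K (c + 1) - K c"
    unfolding K_def sum_subtractf[symmetric]
    by (intro sum.cong) (simp_all add: fwd_diff_def diff_divide_distrib algebra_simps)
  also have "\<dots> = (?u * (C (Suc n) x * C n (c + 1) - C n x * C (Suc n) (c + 1))
      - (?u - 1) * (C (Suc n) x * C n c - C n x * C (Suc n) c)) / (?u * (?u - 1)) / ?h n"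
    unfolding K0 K1 using nz by (simp add: divide_simps)
  also have "?u * (C (Suc n) x * C n (c + 1) - C n x * C (Suc n) (c + 1))
      - (?u - 1) * (C (Suc n) x * C n c - C n x * C (Suc n) c) =
      (C n c + ?u * fwd_diff (C n) c) * C (Suc n) x
      - (C (Suc n) c + ?u * fwd_diff (C (Suc n)) c) * C n x"
    unfolding fwd_diff_def by algebra
  finally show ?thesis
    by (simp add: diff_divide_distrib)
qed

section \<open>Expansion of the Sobolev-type polynomials in the Charlier basis\<close>

text \<open>Removing the top coefficient with \<open>P n\<close> drives the induction. Vanishing
  coefficients, rather than a degree bound, make \<open>n = 0\<close> mean \<open>p = 0\<close>, a
  case that occurs for the difference of two monic polynomials of degree 0.\<close>

lemma monic_basis_expansion:
  fixes P :: "nat \<Rightarrow> 'a::comm_ring_1 poly"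
  assumes "\<And>k. degree (P k) = k \<and> lead_coeff (P k) = 1"
    and "\<And>k. k \<ge> n \<Longrightarrow> coeff p k = 0"
  obtains b where "p = (\<Sum>k<n. smult (b k) (P k))"
proof -
  have "\<exists>b. p = (\<Sum>k<n. smult (b k) (P k))"
    using assms(2)
  proof (induction n arbitrary: p)
    case 0
    then show ?case by (simp add: poly_eq_iff)
  next
    case (Suc n)
    have "coeff (P n) n = 1" and "k > n \<Longrightarrow> coeff (P n) k = 0" for k
      using assms(1)[of n] by (auto simp: coeff_eq_0)
    then have "coeff (p - smult (coeff p n) (P n)) k = 0" if "k \<ge> n" for k
      using Suc.prems[of k] that by (cases "k = n") auto
    from Suc.IH[OF this] obtain b where
      "p - smult (coeff p n) (P n) = (\<Sum>k<n. smult (b k) (P k))" by blast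
    then have "p = (\<Sum>k<Suc n. smult ((b(n := coeff p n)) k) (P k))"
      by (simp add: algebra_simps)
    then show ?case by blast
  qed
  then show thesis using that by blast
qed

lemma fwd_diff_poly_sum:
  "fwd_diff (poly (\<Sum>k\<in>I. smult (b k) (P k))) c = (\<Sum>k\<in>I. b k * fwd_diff (poly (P k)) c)"
  by (simp add: fwd_diff_def poly_sum sum_subtractf[symmetric] right_diff_distrib)

lemma sobolev_inner_sum_right:
  assumes "a > 0" "finite I"
  shows "sobolev_inner a lam c p (\<Sum>k\<in>I. smult (b k) (P k)) =
    (\<Sum>k\<in>I. b k * sobolev_inner a lam c p (P k))"
  unfolding sobolev_inner_def charlier_inner_sum_right[OF assms] fwd_diff_poly_sum
  by (simp add: sum_distrib_left sum.distrib algebra_simps)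

lemma sobolev_orthogonal_lower_degree:
  assumes "a > 0" "monic_orthogonal_seq (sobolev_inner a lam c) Q" "degree p < n"
  shows "sobolev_inner a lam c (Q n) p = 0"
proof -
  have "degree (Q k) = k \<and> lead_coeff (Q k) = 1" for k
    using assms(2) unfolding monic_orthogonal_seq_def by blast
  moreover have "coeff p k = 0" if "k \<ge> n" for k
    using assms(3) that by (simp add: coeff_eq_0)
  ultimately obtain b where b: "p = (\<Sum>k<n. smult (b k) (Q k))"
    using monic_basis_expansion by blast
  show ?thesis
    unfolding b sobolev_inner_sum_right[OF assms(1) finite_lessThan]
    using assms(2) by (intro sum.neutral) (simp add: monic_orthogonal_seq_def)
qed

text \<open>For \<open>k < n\<close>, Sobolev orthogonality of \<open>Q n\<close> to
  \<open>charlier a k\<close> makes their Charlier product equal to minus the difference term, which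
  determines the coefficient. The value \<Delta>Q(c) stays implicit, as it does in
  \<open>coef_A1\<close> and \<open>coef_B1\<close>.\<close>

lemma sobolev_charlier_expansion:
  assumes "a > 0" "monic_orthogonal_seq (sobolev_inner a lam c) Q"
  shows "Q n = charlier a n - smult (lam * fwd_diff (poly (Q n)) c)
    (\<Sum>k<n. smult (fwd_diff (poly (charlier a k)) c / charlier_norm2 a k) (charlier a k))"
proof -
  let ?C = "charlier a"
  have "degree (Q n) = n \<and> lead_coeff (Q n) = 1"
    using assms(2) unfolding monic_orthogonal_seq_def by blast
  then have Q: "degree (Q n) = n" "coeff (Q n) n = 1"
    by auto
  have C: "degree (?C n) = n" "coeff (?C n) n = 1"
    using degree_lead_coeff_charlier[of a n] by auto
  have "coeff (Q n - ?C n) k = 0" if "k \<ge> n" for k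
  proof (cases "k = n")
    case True
    then show ?thesis using Q(2) C(2) by simp
  next
    case False
    then have "coeff (Q n) k = 0" "coeff (?C n) k = 0"
      using that Q(1) C(1) by (intro coeff_eq_0; linarith)+
    then show ?thesis by simp
  qed
  then obtain b where b: "Q n - ?C n = (\<Sum>k<n. smult (b k) (?C k))"
    by (rule monic_basis_expansion[OF degree_lead_coeff_charlier])
  have bk: "b k = - (lam * fwd_diff (poly (Q n)) c) * (fwd_diff (poly (?C k)) c / charlier_norm2 a k)"
    if "k < n" for k
  proof -
    have "charlier_inner a (?C k) (Q n) = charlier_inner a (?C k) (?C n + (\<Sum>j<n. smult (b j) (?C j)))"
      using b by (simp add: algebra_simps)
    also have "\<dots> = (\<Sum>j<n. b j * (if k = j then fact j * a ^ j else 0))"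
      using that by (simp add: charlier_inner_add_right[OF assms(1)] charlier_inner_sum_right[OF assms(1)]
          charlier_inner_charlier[OF assms(1)])
    also have "\<dots> = (\<Sum>j<n. if k = j then b j * charlier_norm2 a j else 0)"
      by (intro sum.cong) (auto simp: charlier_norm2_altdef[OF assms(1)])
    also have "\<dots> = b k * charlier_norm2 a k"
      using that by simp
    finally have "charlier_inner a (?C k) (Q n) = b k * charlier_norm2 a k" .
    moreover have "sobolev_inner a lam c (Q n) (?C k) = 0"
      using sobolev_orthogonal_lower_degree[OF assms] that degree_lead_coeff_charlier by simp
    ultimately have "b k * charlier_norm2 a k = - (lam * fwd_diff (poly (Q n)) c * fwd_diff (poly (?C k)) c)"
      by (simp add: sobolev_inner_def charlier_inner_commute)
    then show ?thesis
      using charlier_norm2_pos[OF assms(1), of k] by (simp add: field_simps)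
  qed
  have "Q n = ?C n + (\<Sum>k<n. smult (b k) (?C k))"
    using b by (simp add: algebra_simps)
  also have "(\<Sum>k<n. smult (b k) (?C k)) = smult (- (lam * fwd_diff (poly (Q n)) c))
      (\<Sum>k<n. smult (fwd_diff (poly (?C k)) c / charlier_norm2 a k) (?C k))"
    by (rule poly_eqI, simp only: coeff_sum coeff_smult sum_distrib_left)
      (intro sum.cong; simp add: bk)
  finally show ?thesis
    by simp
qed

text \<open>Applying \<Delta> at \<open>c\<close> to the expansion shows that the Charlier
  difference is the Sobolev difference times \<open>1 + lam * S\<close>, where \<open>S\<close> is a
  sum of squares over positive norms.\<close>

lemma fwd_diff_sobolev_same_sign:
  assumes "a > 0" "lam \<ge> 0" "monic_orthogonal_seq (sobolev_inner a lam c) Q"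
  shows "fwd_diff (poly (Q n)) c * fwd_diff (poly (charlier a n)) c \<ge> 0"
proof -
  let ?q = "fwd_diff (poly (Q n)) c" and ?d = "\<lambda>k. fwd_diff (poly (charlier a k)) c"
  define S where "S = (\<Sum>k<n. ?d k / charlier_norm2 a k * ?d k)"
  have "S \<ge> 0"
    unfolding S_def using charlier_norm2_pos[OF assms(1)]
    by (intro sum_nonneg) (simp add: less_imp_le)
  have "?q = ?d n - lam * ?q * S"
    using arg_cong[OF sobolev_charlier_expansion[OF assms(1,3), of n], of "\<lambda>p. fwd_diff (poly p) c"]
      fwd_diff_poly_sum[of "\<lambda>k. ?d k / charlier_norm2 a k" "charlier a" "{..<n}" c]
    unfolding S_def by (simp add: fwd_diff_def algebra_simps)
  then have "?d n = ?q * (1 + lam * S)"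
    by (simp add: algebra_simps)
  then have "?q * ?d n = ?q\<^sup>2 * (1 + lam * S)"
    by (simp add: power2_eq_square)
  then show ?thesis
    using \<open>S \<ge> 0\<close> assms(2) by simp
qed

text \<open>The kernel formula turns the sum in the expansion into a combination of the two top
  Charlier polynomials. Index 0 is separate because the sum is then empty.\<close>

lemma sobolev_charlier_connection:
  assumes "a > 0" "monic_orthogonal_seq (sobolev_inner a lam c) Q" "x \<noteq> c" "x \<noteq> c + 1"
  shows "poly (Q n) x = coef_A1 a lam c Q n x * poly (charlier a n) x
    + coef_B1 a lam c Q n x * poly (charlier a (n - 1)) x"
proof (cases n)
  case 0
  then have "degree (Q 0) = 0"
    using assms(2) by (simp add: monic_orthogonal_seq_def)
  then show ?thesis
    using arg_cong[OF sobolev_charlier_expansion[OF assms(1,2), of 0], of "\<lambda>p. poly p x"] 0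
    by (simp add: coef_A1_0 coef_B1_0)
next
  case (Suc m)
  let ?C = "\<lambda>k. poly (charlier a k)"
  have "poly (Q n) x = ?C n x - lam * fwd_diff (poly (Q n)) c *
      (\<Sum>k\<le>m. fwd_diff (?C k) c / charlier_norm2 a k * ?C k x)"
    using arg_cong[OF sobolev_charlier_expansion[OF assms(1,2), of n], of "\<lambda>p. poly p x"]
    unfolding Suc lessThan_Suc_atMost by (simp add: poly_sum del: charlier.simps)
  then show ?thesis
    unfolding charlier_kernel_fwd_diff[OF assms(1,3,4)] coef_A1_def coef_B1_def
    by (simp add: Suc divide_inverse algebra_simps del: charlier.simps inverse_mult_distrib)
qed

section \<open>Finiteness of the zero set of \<open>Lambda\<close>\<close>

text \<open>The shape of \<open>Lambda\<close> with its constants abstracted. Clearing denominators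
  gives a polynomial whose degree 4 coefficient is \<open>1 + e * w\<close>: the term
  \<open>e * w\<close> arises because the factor \<open>x - d\<close> raises the degree of a linear
  numerator.\<close>

lemma finite_zeros_rational:
  fixes c d e k m p q r s t u v w :: real
  assumes "1 + e * w \<noteq> 0"
  defines "L \<equiv> \<lambda>r s x. (r + (x - c) * s) / ((x - c) * (x - c - 1))"
  shows "finite {x. (1 - k * L p q x) * (1 - m * L t u x + (x - d) * e * L v w x)
    + k * L r s x * (e * L v w x) = 0}" (is "finite {x. ?f x = 0}")
proof -
  let ?W = "[:c * (c + 1), - (2 * c + 1), 1:]" and ?L = "\<lambda>r s. [:r - c * s, s:]"
  define P where "P = (?W - smult k (?L p q)) * (?W - smult m (?L t u) + smult e ([:- d, 1:] * ?L v w))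
    + smult (k * e) (?L r s * ?L v w)"
  have "coeff P 4 = 1 + e * w"
    unfolding P_def by (simp add: eval_nat_numeral algebra_simps)
  then have "P \<noteq> 0"
    using assms(1) by auto
  have "poly P x = ?f x * (poly ?W x)\<^sup>2" if "x \<noteq> c" "x \<noteq> c + 1" for x
  proof -
    have W: "poly ?W x = (x - c) * (x - c - 1)"
      by (simp add: algebra_simps)
    then have "poly ?W x \<noteq> 0"
      using that by auto
    have L: "poly [:r - c * s, s:] x = L r s x * poly ?W x" for r s
    proof -
      have "poly [:r - c * s, s:] x = r + (x - c) * s"
        by (simp add: algebra_simps)
      then show ?thesis
        using \<open>poly ?W x \<noteq> 0\<close> unfolding L_def W[symmetric] by (simp del: poly_pCons)
    qed
    have "poly [:- d, 1:] x = x - d"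
      by simp
    then show ?thesis
      unfolding P_def poly_add poly_diff poly_mult poly_smult L
      by algebra
  qed
  \<comment> \<open>The values of \<open>?f\<close> at the poles depend on division by zero, so both
    points are simply added to the root set.\<close>
  then have "{x. ?f x = 0} \<subseteq> {c, c + 1} \<union> {x. poly P x = 0}"
    by auto
  then show ?thesis
    by (rule finite_subset) (simp add: poly_roots_finite[OF \<open>P \<noteq> 0\<close>])
qed

lemma finite_zeros_Lambda:
  fixes a lam c :: real and n :: nat and Q :: "nat \<Rightarrow> real poly"
  assumes "a > 0" "lam \<ge> 0" "n \<ge> 1" "monic_orthogonal_seq (sobolev_inner a lam c) Q"
  defines "A \<equiv> coef_A1 a lam c Q" and "B \<equiv> coef_B1 a lam c Q"
  shows "finite {x. Lambda a A B n x = 0}"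
proof -
  let ?C = "\<lambda>k. poly (charlier a k)"
  let ?k = "\<lambda>n. lam * (fwd_diff (poly (Q n)) c / charlier_norm2 a (n - 1))"
  \<comment> \<open>The constant factor in \<open>coef_B1\<close> of index \<open>n - 1\<close>
    divided by \<open>a * (real n - 1)\<close>. At \<open>n = 1\<close> this is 0 by division by
    zero, and the sign argument still applies.\<close>
  let ?e = "?k (n - 1) / (a * (real n - 1))"
  let ?v = "fwd_diff (?C (n - 1)) c"
  let ?L = "\<lambda>j x. (?C j c + (x - c) * fwd_diff (?C j) c) / ((x - c) * (x - c - 1))"
  have "?e * ?v = lam * (fwd_diff (poly (Q (n - 1))) c * ?v) /
      (charlier_norm2 a (n - 1 - 1) * (a * (real n - 1)))"
    by (simp add: mult_ac)
  also have "\<dots> \<ge> 0"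
    using assms(1-3) fwd_diff_sobolev_same_sign[OF assms(1,2,4), of "n - 1"]
      charlier_norm2_pos[OF assms(1), of "n - 1 - 1"]
    by (intro divide_nonneg_nonneg mult_nonneg_nonneg[OF assms(2)]) auto
  finally have "1 + ?e * ?v \<noteq> 0"
    by simp
  from finite_zeros_rational[OF this, where c = c and k = "?k n"
      and p = "?C (n - 1) c" and q = "fwd_diff (?C (n - 1)) c" and m = "?k (n - 1)"
      and t = "?C (n - 1 - 1) c" and u = "fwd_diff (?C (n - 1 - 1)) c" and d = "real n + a - 1"
      and v = "?C (n - 1) c" and r = "?C n c" and s = "fwd_diff (?C n) c"]
  have "finite {x. (1 - ?k n * ?L (n - 1) x) * (1 - ?k (n - 1) * ?L (n - 1 - 1) x
      + (x - (real n + a - 1)) * ?e * ?L (n - 1) x) + ?k n * ?L n x * (?e * ?L (n - 1) x) = 0}" .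
  moreover have "Lambda a A B n x = (1 - ?k n * ?L (n - 1) x) * (1 - ?k (n - 1) * ?L (n - 1 - 1) x
      + (x - (real n + a - 1)) * ?e * ?L (n - 1) x) + ?k n * ?L n x * (?e * ?L (n - 1) x)" for x
    unfolding Lambda_def coef_A2_def coef_B2_def A_def B_def coef_A1_def coef_B1_def
    by (simp add: diff_diff_eq2 add.commute algebra_simps(1-3) mult_ac)
  ultimately show ?thesis
    by simp
qed

section \<open>The linear system over two Charlier polynomials and the ladder relations\<close>

text \<open>The differences need the connection formula at \<open>x + 1\<close> as well as at
  \<open>x\<close>; this is why \<open>c - 1\<close> is excluded besides the poles.\<close>

lemma sobolev_charlier_system:
  fixes a lam c :: real and n :: nat and Q :: "nat \<Rightarrow> real poly"
  assumes "a > 0" "n \<ge> 1" "monic_orthogonal_seq (sobolev_inner a lam c) Q" "x \<notin> {c - 1, c, c + 1}"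
  defines "A \<equiv> coef_A1 a lam c Q" and "B \<equiv> coef_B1 a lam c Q" and "C \<equiv> \<lambda>k. poly (charlier a k)"
  shows "poly (Q n) x = A n x * C n x + B n x * C (n - 1) x"
    and "fwd_diff (poly (Q n)) x = coef_C1 a A B n x * C n x + coef_D1 a A B n x * C (n - 1) x"
    and "poly (Q (n - 1)) x = coef_A2 a A B n x * C n x + coef_B2 a A B n x * C (n - 1) x"
    and "fwd_diff (poly (Q (n - 1))) x = coef_C2 a A B n x * C n x + coef_D2 a A B n x * C (n - 1) x"
proof -
  obtain m where n: "n = Suc m"
    using assms(2) by (cases n) auto
  have nm: "n - 1 = m" "real n = real m + 1"
    using n by auto
  have Q: "poly (Q j) y = A j y * C j y + B j y * C (j - 1) y" if "y \<in> {x, x + 1}" for j y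
    using sobolev_charlier_connection[OF assms(1,3), of y j] that assms(4)
    unfolding A_def B_def C_def by auto
  show Qn: "poly (Q n) x = A n x * C n x + B n x * C (n - 1) x"
    using Q by simp
  have rec: "C n y = (y - real m - a) * C m y - real m * a * C (m - 1) y" for y
    unfolding C_def n by (rule poly_charlier_Suc)
  have shift_n: "C n (x + 1) = C n x + (real m + 1) * C m x"
    unfolding C_def n using poly_charlier_shift[of a "Suc m" x] by (simp add: add.commute)
  \<comment> \<open>The recurrence replaces \<open>real m * C (m - 1) x\<close> as a whole, so only
    \<open>a\<close> is divided out and \<open>m = 0\<close> is allowed.\<close>
  have shift_m: "C m (x + 1) = ((x - real m) * C m x - C n x) / a"
    using poly_charlier_shift[of a m x] rec[of x] assms(1) unfolding C_def by (simp add: field_simps)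
  show "fwd_diff (poly (Q n)) x = coef_C1 a A B n x * C n x + coef_D1 a A B n x * C (n - 1) x"
  proof -
    have 1: "poly (Q n) (x + 1) = A n (x + 1) * C n (x + 1) + B n (x + 1) * C m (x + 1)"
      and 2: "poly (Q n) x = A n x * C n x + B n x * C m x"
      using Q n by simp_all
    show ?thesis
      unfolding fwd_diff_def coef_C1_def coef_D1_def 1 2 shift_n shift_m nm
      using assms(1) by (simp add: field_simps)
  qed
  have "poly (Q (n - 1)) x = coef_A2 a A B n x * C n x + coef_B2 a A B n x * C (n - 1) x \<and>
    fwd_diff (poly (Q (n - 1))) x = coef_C2 a A B n x * C n x + coef_D2 a A B n x * C (n - 1) x"
  \<comment> \<open>Eliminating \<open>C (m - 1)\<close> itself divides by \<open>real m\<close>.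
    For \<open>m = 0\<close> it does not occur, since \<open>A 0\<close> is constantly 1 and
    \<open>B 0\<close> constantly 0.\<close>
  proof (cases "m = 0")
    case True
    have "degree (Q 0) = 0"
      using assms(3) by (simp add: monic_orthogonal_seq_def)
    then have AB: "A 0 y = 1" "B 0 y = 0" for y
      by (simp_all add: A_def B_def coef_A1_0 coef_B1_0)
    show ?thesis
      using Q[of x 0] Q[of "x + 1" 0] AB True n shift_m assms(1)
      by (simp add: coef_A2_def coef_B2_def coef_C2_def coef_D2_def fwd_diff_def C_def field_simps)
  next
    case False
    have prev: "C (m - 1) y = ((y - real m - a) * C m y - C n y) / (a * real m)" for y
      using rec[of y] assms(1) False by (simp add: field_simps)
    have 1: "poly (Q m) x = A m x * C m x + B m x * (((x - real m - a) * C m x - C n x) / (a * real m))"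
      using Q[of x m] prev[of x] by simp
    have 2: "poly (Q m) (x + 1) = A m (x + 1) * C m (x + 1)
        + B m (x + 1) * (((x + 1 - real m - a) * C m (x + 1) - C n (x + 1)) / (a * real m))"
      using Q[of "x + 1" m] prev[of "x + 1"] by simp
    have nz: "a \<noteq> 0" "real m \<noteq> 0"
      using assms(1) False by auto
    show ?thesis
      unfolding fwd_diff_def 1 2 shift_n shift_m coef_A2_def coef_B2_def coef_C2_def coef_D2_def nm
      using nz by (simp add: field_simps power2_eq_square)
  qed
  then show "poly (Q (n - 1)) x = coef_A2 a A B n x * C n x + coef_B2 a A B n x * C (n - 1) x"
    and "fwd_diff (poly (Q (n - 1))) x = coef_C2 a A B n x * C n x + coef_D2 a A B n x * C (n - 1) x"
    by blast+
qed

theorem theorem2: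
  fixes a lam c :: real and n :: nat and Q :: "nat \<Rightarrow> real poly"
  defines "A \<equiv> coef_A1 a lam c Q" and "B \<equiv> coef_B1 a lam c Q"
  assumes "n \<ge> 1" and "lam \<ge> 0" and "a > 0"
    and "no_increase_points c"
    and "monic_orthogonal_seq (sobolev_inner a lam c) Q"
  shows "finite {x. Lambda a A B n x = 0} \<and>
    (\<forall>x. x \<notin> {c - 1, c, c + 1} \<and> Lambda a A B n x \<noteq> 0 \<longrightarrow>
       lowering_op a A B n (poly (Q n)) x = Xi 1 a A B n x * poly (Q (n - 1)) x \<and>
       raising_op a A B n (poly (Q (n - 1))) x = Theta 2 a A B n x * poly (Q n) x)"
proof (intro conjI allI impI; (elim conjE)?)
  show "finite {x. Lambda a A B n x = 0}"
    unfolding A_def B_def by (rule finite_zeros_Lambda) fact+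
next
  fix x assume x: "x \<notin> {c - 1, c, c + 1}" and nz: "Lambda a A B n x \<noteq> 0"
  \<comment> \<open>Substituting the four expansions leaves Cramer's rule for the differences in
    terms of \<open>Q n\<close> and \<open>Q (n - 1)\<close>, an identity checked after clearing
    \<open>Lambda\<close>.\<close>
  note sys = sobolev_charlier_system[OF assms(5,3,7) x, folded A_def B_def]
  show "lowering_op a A B n (poly (Q n)) x = Xi 1 a A B n x * poly (Q (n - 1)) x"
    unfolding lowering_op_def Xi_def coef_A_def coef_B_def sys using nz
    by (simp add: field_simps) (simp add: Lambda_def algebra_simps)
  show "raising_op a A B n (poly (Q (n - 1))) x = Theta 2 a A B n x * poly (Q n) x"
    unfolding raising_op_def Theta_def coef_A_def coef_B_def sys using nz
    by (simp add: field_simps) (simp add: Lambda_def algebra_simps)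
qed

end
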